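(* There is a function $g:(0,1)\to[0,\infty)$ with $g(p)\to0$ as $p\to0$ such that the following holds. For every $n\in\mathbb{N}$, every $p\in(0,1)$, every $n$-variable polynomial $f$ (of arbitrary degree) with real nonnegative coefficients, and every real $x$ not equal to the constant coefficient of $f$, if $\boldsymbol{\xi}=(\xi_1,\dots,\xi_n)$ has independent $\mathrm{Ber}(p)$ entries then \[ \Pr\left(f(\boldsymbol{\xi})=x\right)\le\frac1e+g(p). \]
   Context: $\mathrm{Ber}(p)$ denotes the distribution of a random variable equal to $1$ with probability $p$ and $0$ with probability $1-p$. *)

theory Defs
  imports "HOL-Probability.Probability" "HOL-Probability.Product_PMF" "HOL-Library.Poly_Mapping"
begin

text \<open>
  A multivariate polynomial is a finitely supported map from monomials (finitely supported
  exponent vectors \<open>nat \<Rightarrow>\<^sub>0 nat\<close>) to coefficients; the zero monomial \<open>0\<close> carries the constant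
  coefficient. The \<open>n\<close> variables are indexed by \<open>{..<n}\<close>.
\<close>

type_synonym 'a mpolynomial = "(nat \<Rightarrow>\<^sub>0 nat) \<Rightarrow>\<^sub>0 'a"

abbreviation mcoeff :: "'a::zero mpolynomial \<Rightarrow> (nat \<Rightarrow>\<^sub>0 nat) \<Rightarrow> 'a" where
  "mcoeff f m \<equiv> Poly_Mapping.lookup f m"

definition mpolynomials :: "nat \<Rightarrow> 'a::zero mpolynomial set" where
  "mpolynomials n = {f. \<forall>m \<in> Poly_Mapping.keys f. Poly_Mapping.keys m \<subseteq> {..<n}}"

definition meval :: "'a::comm_semiring_1 mpolynomial \<Rightarrow> (nat \<Rightarrow> 'a) \<Rightarrow> 'a" where
  "meval f v =
     (\<Sum>m \<in> Poly_Mapping.keys f.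
        mcoeff f m * (\<Prod>i \<in> Poly_Mapping.keys m. v i ^ Poly_Mapping.lookup m i))"

definition Ber :: "real \<Rightarrow> real pmf" where
  "Ber p = map_pmf of_bool (bernoulli_pmf p)"

text \<open>
  The joint law of \<open>n\<close> independent \<open>Ber p\<close> variables; coordinates outside \<open>{..<n}\<close> are
  constantly \<open>0\<close>.
\<close>

definition Ber_vector :: "nat \<Rightarrow> real \<Rightarrow> (nat \<Rightarrow> real) pmf" where
  "Ber_vector n p = Pi_pmf {..<n} 0 (\<lambda>_. Ber p)"

end

theory Submission
  imports Defs
begin

text \<open>
  Identify \<open>\<xi> \<in> {0,1}\<^sup>n\<close> with its support. As the coefficients are nonnegative, every set \<open>S\<close> in the
  level set \<open>F\<close> contains a least member of \<open>F\<close>, its core, namely the union of the monomials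
  supported in \<open>S\<close>; it is nonempty because \<open>x\<close> is not the constant coefficient. Let \<open>A\<close> be the up-set
  generated by \<open>F\<close> and reveal the coordinates in increasing order. Call a coordinate \<open>v\<close> pivotal for
  \<open>S\<close> if \<open>S \<inter> {..<v}\<close> together with \<open>v\<close> lies in \<open>A\<close>. A set avoids \<open>A\<close> only if all of its pivotal
  coordinates fail, which makes \<open>(1 - p)\<^bsup>-N\<^esup>\<close>, where \<open>N\<close> is the number of pivotal coordinates, have
  expectation at most \<open>1\<close> on the complement of \<open>A\<close>. On the other hand, deleting the largest element
  of its core from \<open>S \<in> F\<close> gives a set outside \<open>A\<close> for which that element is pivotal, so
  \<open>F\<close> has probability at most \<open>p / (1 - p)\<close> times the expectation of \<open>N\<close> off \<open>A\<close>.
  Since \<open>p N (1 - p)\<^sup>N \<le> p N exp (- p N) \<le> 1 / e\<close>, the bound \<open>1 / (e (1 - p))\<close> follows.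
\<close>

section \<open>Product weights, pivotal coordinates and families with cores\<close>

definition Bernoulli_weight :: "real \<Rightarrow> nat \<Rightarrow> nat set \<Rightarrow> real" where
  "Bernoulli_weight p n S = (\<Prod>i<n. if i \<in> S then p else 1 - p)"

text \<open>Whether \<open>v\<close> is pivotal depends only on the part of \<open>S\<close> below
  \<open>v\<close>, not on whether \<open>v\<close> lies in \<open>S\<close>: it is settled just
  before \<open>v\<close> is revealed.\<close>

definition pivotal :: "nat set set \<Rightarrow> nat \<Rightarrow> nat set \<Rightarrow> nat set" where
  "pivotal A n S = {v. v < n \<and> insert v (S \<inter> {..<v}) \<in> A}"

lemma finite_pivotal: "finite (pivotal A n S)"
  by (rule finite_subset[of _ "{..<n}"]) (auto simp: pivotal_def)

lemma Bernoulli_weight_nonneg: "0 \<le> p \<Longrightarrow> p \<le> 1 \<Longrightarrow> 0 \<le> Bernoulli_weight p n S"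
  unfolding Bernoulli_weight_def by (rule prod_nonneg) auto

lemma Bernoulli_weight_insert:
  assumes "v < n" "v \<notin> R" "p < 1"
  shows "Bernoulli_weight p n (insert v R) = p / (1 - p) * Bernoulli_weight p n R"
proof -
  have split: "Bernoulli_weight p n S =
      (if v \<in> S then p else 1 - p) * (\<Prod>i\<in>{..<n} - {v}. if i \<in> S then p else 1 - p)" for S
    unfolding Bernoulli_weight_def by (rule prod.remove) (use assms in auto)
  have "(\<Prod>i\<in>{..<n} - {v}. if i \<in> insert v R then p else 1 - p) =
      (\<Prod>i\<in>{..<n} - {v}. if i \<in> R then p else 1 - p)"
    by (rule prod.cong) auto
  then show ?thesis using assms split[of R] split[of "insert v R"] by simp
qed

lemma sum_Pow_lessThan_Suc:
  fixes h :: "nat set \<Rightarrow> real"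
  shows "sum h (Pow {..<Suc n}) = (\<Sum>S\<in>Pow {..<n}. h S + h (insert n S))"
proof -
  have inj: "inj_on (insert n) (Pow {..<n})"
  proof (rule inj_onI)
    fix S T assume "S \<in> Pow {..<n}" "T \<in> Pow {..<n}" "insert n S = insert n T"
    moreover from this have "n \<notin> S" "n \<notin> T" by auto
    ultimately show "S = T" by (simp add: insert_ident)
  qed
  have "Pow {..<n} \<inter> insert n ` Pow {..<n} = {}" by auto
  then have "sum h (Pow {..<n} \<union> insert n ` Pow {..<n}) =
      sum h (Pow {..<n}) + sum h (insert n ` Pow {..<n})"
    by (intro sum.union_disjoint) auto
  then show ?thesis
    unfolding lessThan_Suc Pow_insert sum.reindex[OF inj] sum.distrib comp_def .
qed

text \<open>Revealing coordinate \<open>n\<close> never increases the sum. If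
  \<open>insert n S\<close> lies in \<open>A\<close> and \<open>S\<close> does not, only
  \<open>S\<close> survives, and its factor \<open>1 - p\<close> is cancelled by the new pivotal
  coordinate \<open>n\<close>. If neither lies in \<open>A\<close>, both survive, with factors
  adding up to 1 and no new pivotal coordinate.\<close>

lemma sum_weight_pivotal_le_1:
  assumes p: "0 < p" "p < 1"
    and up: "\<And>S T. S \<in> A \<Longrightarrow> S \<subseteq> T \<Longrightarrow> T \<in> A"
  shows "(\<Sum>S\<in>Pow {..<n}. if S \<in> A then 0
            else Bernoulli_weight p n S / (1 - p) ^ card (pivotal A n S)) \<le> 1"
proof (induction n)
  case 0
  show ?case
    unfolding lessThan_0 Pow_empty by (simp add: Bernoulli_weight_def) (simp add: pivotal_def)
next
  case (Suc n)
  let ?h = "\<lambda>n S. if S \<in> A then 0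
    else Bernoulli_weight p n S / (1 - p) ^ card (pivotal A n S)"
  have "?h (Suc n) S + ?h (Suc n) (insert n S) \<le> ?h n S" if S: "S \<subseteq> {..<n}" for S
  proof -
    have nS: "n \<notin> S" and Sn: "S \<inter> {..<n} = S" using S by auto
    have "insert n S \<inter> {..<v} = S \<inter> {..<v}" if "v \<le> n" for v
      using that by auto
    then have piv_insert: "pivotal A (Suc n) (insert n S) = pivotal A (Suc n) S"
      unfolding pivotal_def less_Suc_eq_le by (intro Collect_cong conj_cong) simp_all
    have "v \<in> pivotal A (Suc n) S \<longleftrightarrow> v \<in> pivotal A n S \<or> v = n \<and> insert n S \<in> A" for v
      unfolding pivotal_def mem_Collect_eq less_Suc_eq using Sn by metis
    then have piv: "pivotal A (Suc n) S = pivotal A n S \<union> (if insert n S \<in> A then {n} else {})"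
      by (intro set_eqI) simp
    have "n \<notin> pivotal A n S" by (simp add: pivotal_def)
    then have card: "card (pivotal A (Suc n) S) =
        card (pivotal A n S) + (if insert n S \<in> A then 1 else 0)"
      by (simp add: piv finite_pivotal)
    have w: "Bernoulli_weight p (Suc n) S = (1 - p) * Bernoulli_weight p n S"
      using nS by (simp add: Bernoulli_weight_def)
    have "(\<Prod>i<n. if i \<in> insert n S then p else 1 - p) = (\<Prod>i<n. if i \<in> S then p else 1 - p)"
      by (rule prod.cong) auto
    then have w': "Bernoulli_weight p (Suc n) (insert n S) = p * Bernoulli_weight p n S"
      by (simp add: Bernoulli_weight_def)
    consider "S \<in> A" "insert n S \<in> A" | "S \<notin> A" "insert n S \<in> A" | "S \<notin> A" "insert n S \<notin> A"
      using up by blast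
    then show ?thesis
    proof cases
      case 3
      then show ?thesis
        by (simp add: piv_insert card w w' add_divide_distrib[symmetric]) (simp add: algebra_simps)
    qed (use p in \<open>simp_all add: piv_insert card w w'\<close>)
  qed
  then have "(\<Sum>S\<in>Pow {..<Suc n}. ?h (Suc n) S) \<le> (\<Sum>S\<in>Pow {..<n}. ?h n S)"
    unfolding sum_Pow_lessThan_Suc by (intro sum_mono) auto
  then show ?case using Suc.IH by (rule order_trans)
qed

text \<open>Two instances of \<open>1 + y \<le> exp y\<close>: at \<open>y = - p\<close> for the
  power, at \<open>y = p * N - 1\<close> for the linear factor.\<close>

lemma mult_power_le_inverse_exp:
  fixes p :: real
  assumes "0 < p" "p < 1"
  shows "p * real N * (1 - p) ^ N \<le> 1 / exp 1"
proof -
  have "(1 - p) ^ N \<le> exp (- p) ^ N"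
    using assms exp_ge_add_one_self[of "- p"] by (intro power_mono) auto
  also have "\<dots> = exp (- (p * N))" by (simp add: exp_of_nat_mult[symmetric] mult.commute)
  finally have "p * real N * (1 - p) ^ N \<le> p * real N * exp (- (p * N))"
    using assms by (intro mult_left_mono) auto
  also have "\<dots> \<le> exp (p * N - 1) * exp (- (p * N))"
    using exp_ge_add_one_self[of "p * N - 1"] by (intro mult_right_mono) auto
  also have "\<dots> = 1 / exp 1" by (subst exp_add[symmetric]) (simp add: exp_minus inverse_eq_divide)
  finally show ?thesis .
qed

lemma sum_weight_le_of_cores:
  fixes F :: "nat set set"
  assumes p: "0 < p" "p < 1"
    and F: "F \<subseteq> Pow {..<n}"
    and core: "\<And>S. S \<in> F \<Longrightarrow> \<exists>U\<in>F. U \<noteq> {} \<and> U \<subseteq> S \<and> (\<forall>M\<in>F. M \<subseteq> S \<longrightarrow> U \<subseteq> M)"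
  shows "sum (Bernoulli_weight p n) F \<le> 1 / (exp 1 * (1 - p))"
proof -
  define A where "A = {S. \<exists>M\<in>F. M \<subseteq> S}"
  define B where "B = Pow {..<n} - A"
  let ?w = "Bernoulli_weight p n" and ?N = "pivotal A n"
  have finB: "finite B" by (simp add: B_def)
  \<comment> \<open>Each \<open>S\<close> in \<open>F\<close> is charged to the pair of
    \<open>S - {v}\<close> and \<open>v\<close>, where \<open>v\<close> is the largest element of
    its core.\<close>
  define P where "P = {(R, v). R \<in> B \<and> v \<in> ?N R \<and> v \<notin> R}"
  have "F \<subseteq> (\<lambda>(R, v). insert v R) ` P"
  proof
    fix S assume S: "S \<in> F"
    from core[OF S] obtain U where UF: "U \<in> F"
      and *: "U \<noteq> {} \<and> U \<subseteq> S \<and> (\<forall>M\<in>F. M \<subseteq> S \<longrightarrow> U \<subseteq> M)" by (rule bexE)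
    have U: "U \<in> F" "U \<noteq> {}" "U \<subseteq> S" using UF * by simp_all
    have least: "U \<subseteq> M" if "M \<in> F" "M \<subseteq> S" for M using * that by simp
    have "U \<subseteq> {..<n}" using U F by auto
    then have finU: "finite U" using finite_lessThan by (rule finite_subset)
    define v where "v = Max U"
    have v: "v \<in> U" using U finU by (simp add: v_def)
    have Uv: "u \<le> v" if "u \<in> U" for u using finU that by (simp add: v_def)
    \<comment> \<open>A member of \<open>F\<close> inside \<open>S - {v}\<close> would contain the
      core \<open>U\<close>, hence \<open>v\<close>.\<close>
    have "S - {v} \<notin> A" using least v unfolding A_def by blast
    then have "S - {v} \<in> B" using S F by (auto simp: B_def)
    moreover have "U \<subseteq> insert v ((S - {v}) \<inter> {..<v})" using U Uv by force
    then have "v \<in> ?N (S - {v})" using U v F by (auto simp: pivotal_def A_def)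
    moreover have "S = insert v (S - {v})" using v U by auto
    ultimately show "S \<in> (\<lambda>(R, v). insert v R) ` P"
      by (intro image_eqI[of _ _ "(S - {v}, v)"]) (simp_all add: P_def)
  qed
  moreover have finS: "finite (Sigma B ?N)" using finB finite_pivotal by (intro finite_SigmaI)
  moreover have sub: "P \<subseteq> Sigma B ?N" by (auto simp: P_def)
  moreover from sub finS have finP: "finite P" by (rule finite_subset)
  ultimately have "sum ?w F \<le> sum ?w ((\<lambda>(R, v). insert v R) ` P)"
    using p by (intro sum_mono2 Bernoulli_weight_nonneg finite_imageI) simp_all
  \<comment> \<open>Several pairs may yield the same set, so passing from sets to pairs gives only
    an inequality.\<close>
  also have "\<dots> \<le> (\<Sum>z\<in>P. ?w (insert (snd z) (fst z)))"
    using p finP sum_image_le[OF finP, of ?w "\<lambda>(R, v). insert v R"]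
    by (simp add: case_prod_unfold Bernoulli_weight_nonneg comp_def)
  also have "\<dots> = (\<Sum>z\<in>P. p / (1 - p) * ?w (fst z))"
  proof (rule sum.cong[OF refl])
    fix z assume "z \<in> P"
    then have "snd z < n" "snd z \<notin> fst z" by (simp_all add: P_def pivotal_def case_prod_unfold)
    then show "?w (insert (snd z) (fst z)) = p / (1 - p) * ?w (fst z)"
      using p(2) by (rule Bernoulli_weight_insert)
  qed
  \<comment> \<open>Extending the sum to all pivotal \<open>v\<close> adds nonnegative terms and
    turns the inner sum into a multiple of \<open>card (?N R)\<close>.\<close>
  also have "\<dots> \<le> (\<Sum>(R, v)\<in>Sigma B ?N. p / (1 - p) * ?w R)"
    unfolding case_prod_unfold
    using p by (intro sum_mono2 finS sub) (simp add: Bernoulli_weight_nonneg)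
  also have "\<dots> = (\<Sum>R\<in>B. real (card (?N R)) * (p / (1 - p) * ?w R))"
    using finB finite_pivotal by (subst sum.Sigma[symmetric]) simp_all
  also have "\<dots> \<le> (\<Sum>R\<in>B. 1 / (exp 1 * (1 - p)) * (?w R / (1 - p) ^ card (?N R)))"
  proof (rule sum_mono)
    fix R
    \<comment> \<open>Inserting \<open>(1 - p) ^ card (?N R)\<close> and its reciprocal isolates the
      factor that is at most \<open>1 / exp 1\<close>; what remains is summed by
      \<open>sum_weight_pivotal_le_1\<close>.\<close>
    have "real (card (?N R)) * (p / (1 - p) * ?w R) =
        p * real (card (?N R)) * (1 - p) ^ card (?N R) * (?w R / ((1 - p) * (1 - p) ^ card (?N R)))"
      using p by simp
    also have "\<dots> \<le> 1 / exp 1 * (?w R / ((1 - p) * (1 - p) ^ card (?N R)))"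
      using p by (intro mult_right_mono mult_power_le_inverse_exp) (auto simp: Bernoulli_weight_nonneg)
    finally show "real (card (?N R)) * (p / (1 - p) * ?w R) \<le>
        1 / (exp 1 * (1 - p)) * (?w R / (1 - p) ^ card (?N R))" by simp
  qed
  also have "\<dots> = 1 / (exp 1 * (1 - p)) * (\<Sum>R\<in>B. ?w R / (1 - p) ^ card (?N R))"
    by (simp only: sum_distrib_left)
  also have "(\<Sum>R\<in>B. ?w R / (1 - p) ^ card (?N R)) =
      (\<Sum>S\<in>Pow {..<n}. if S \<in> A then 0 else ?w S / (1 - p) ^ card (?N S))"
    by (intro sum.mono_neutral_cong_left) (auto simp: B_def)
  also have "1 / (exp 1 * (1 - p)) * \<dots> \<le> 1 / (exp 1 * (1 - p)) * 1"
    using p by (intro mult_left_mono sum_weight_pivotal_le_1) (auto simp: A_def)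
  finally show ?thesis by simp
qed

section \<open>Level sets of nonnegative polynomials on the cube\<close>

lemma meval_of_bool:
  fixes f :: "real mpolynomial"
  shows "meval f (\<lambda>i. of_bool (i \<in> S)) =
    sum (mcoeff f) {m \<in> Poly_Mapping.keys f. Poly_Mapping.keys m \<subseteq> S}"
proof -
  have monomial: "(\<Prod>i\<in>Poly_Mapping.keys m. (of_bool (i \<in> S) :: real) ^ Poly_Mapping.lookup m i) =
      of_bool (Poly_Mapping.keys m \<subseteq> S)" for m :: "nat \<Rightarrow>\<^sub>0 nat"
  proof (cases "Poly_Mapping.keys m \<subseteq> S")
    case True
    then show ?thesis by (auto intro!: prod.neutral)
  next
    case False
    then obtain i where "i \<in> Poly_Mapping.keys m" "i \<notin> S" by auto
    \<comment> \<open>As a key of \<open>m\<close>, \<open>i\<close> has a positive exponent, so its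
      factor is 0.\<close>
    then show ?thesis using False by (auto intro!: bexI[of _ i] simp: in_keys_iff)
  qed
  have "mcoeff f m * of_bool (Poly_Mapping.keys m \<subseteq> S) =
      (if Poly_Mapping.keys m \<subseteq> S then mcoeff f m else 0)" for m
    by simp
  then show ?thesis unfolding meval_def monomial
    by (simp only: sum.inter_filter finite_keys)
qed

text \<open>If \<open>M \<subseteq> S\<close> gives the same value, the monomials supported in
  \<open>S\<close> but not in \<open>M\<close> have coefficients summing to 0. These are
  nonnegative, and keys have nonzero coefficients, so there are no such monomials and
  \<open>M\<close> contains every monomial supported in \<open>S\<close>.\<close>

lemma meval_level_core:
  fixes f :: "real mpolynomial"
  assumes nonneg: "\<And>m. 0 \<le> mcoeff f m" and x: "x \<noteq> mcoeff f 0"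
    and S: "meval f (\<lambda>i. of_bool (i \<in> S)) = x"
  shows "\<exists>U. meval f (\<lambda>i. of_bool (i \<in> U)) = x \<and> U \<noteq> {} \<and> U \<subseteq> S \<and>
    (\<forall>M. meval f (\<lambda>i. of_bool (i \<in> M)) = x \<longrightarrow> M \<subseteq> S \<longrightarrow> U \<subseteq> M)"
proof -
  define K where "K T = {m \<in> Poly_Mapping.keys f. Poly_Mapping.keys m \<subseteq> T}" for T
  define U where "U = \<Union> (Poly_Mapping.keys ` K S)"
  note ev = meval_of_bool[of f, folded K_def]
  have US: "U \<subseteq> S" by (auto simp: U_def K_def)
  have "K U = K S" by (auto simp: U_def K_def)
  then have Ux: "meval f (\<lambda>i. of_bool (i \<in> U)) = x" using S by (simp add: ev)
  have "U \<noteq> {}"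
  proof
    assume "U = {}"
    \<comment> \<open>Over the empty set only the constant monomial can survive, so the value would
      be the constant coefficient.\<close>
    then have "K U = Poly_Mapping.keys f \<inter> {0}" by (auto simp: K_def)
    then have "sum (mcoeff f) (K U) = mcoeff f 0"
      by (cases "0 \<in> Poly_Mapping.keys f") (simp_all add: in_keys_iff)
    then show False using Ux x by (simp add: ev)
  qed
  moreover have "U \<subseteq> M" if M: "meval f (\<lambda>i. of_bool (i \<in> M)) = x" "M \<subseteq> S" for M
  proof -
    have sub: "K M \<subseteq> K S" using M by (auto simp: K_def)
    have fin: "finite (K S)" by (simp add: K_def)
    have "sum (mcoeff f) (K S - K M) = 0"
      using M S by (simp add: sum_diff[OF fin sub] ev)
    then have "\<forall>m\<in>K S - K M. mcoeff f m = 0"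
      using fin nonneg by (subst (asm) sum_nonneg_eq_0_iff) auto
    then have "K S - K M = {}" by (auto simp: K_def in_keys_iff)
    then show ?thesis by (auto simp: U_def K_def)
  qed
  ultimately show ?thesis using Ux US by blast
qed

section \<open>From weights to the law of the random vector\<close>

lemma prob_Ber_vector:
  assumes p: "0 \<le> p" "p \<le> 1"
  shows "measure_pmf.prob (Ber_vector n p) E =
    sum (Bernoulli_weight p n) {S \<in> Pow {..<n}. (\<lambda>i. of_bool (i \<in> S)) \<in> E}"
proof -
  let ?P = "Pi_pmf {..<n} False (\<lambda>_. bernoulli_pmf p)"
  let ?G = "{S \<in> Pow {..<n}. (\<lambda>i. of_bool (i \<in> S) :: real) \<in> E}"
  have "Ber_vector n p = map_pmf (\<lambda>h. of_bool \<circ> h) ?P"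
    unfolding Ber_vector_def Ber_def by (rule Pi_pmf_map) auto
  then have "measure_pmf.prob (Ber_vector n p) E = measure_pmf.prob ?P ((\<lambda>h. of_bool \<circ> h) -` E)"
    by simp
  also have "\<dots> = measure_pmf.prob ?P ((\<lambda>S i. i \<in> S) ` ?G)"
  \<comment> \<open>The two events may differ at functions that are true somewhere outside
    \<open>{..<n}\<close>; these have probability 0, the default there being
    \<open>False\<close>.\<close>
  proof (rule measure_pmf.finite_measure_eq_AE)
    have "h \<in> (\<lambda>h. of_bool \<circ> h) -` E \<longleftrightarrow> h \<in> (\<lambda>S i. i \<in> S) ` ?G"
      if "h \<in> set_pmf ?P" for h
    proof -
      have out: "h i \<Longrightarrow> i < n" for i
        using set_Pi_pmf_subset[of "{..<n}" False "\<lambda>_. bernoulli_pmf p"] that by auto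
      have "h \<in> (\<lambda>S i. i \<in> S) ` ?G" if "of_bool \<circ> h \<in> E"
        using that out by (intro image_eqI[of _ _ "{i. h i}"]) (auto simp: comp_def)
      then show ?thesis by (auto simp: comp_def)
    qed
    then show "AE h in measure_pmf ?P. h \<in> (\<lambda>h. of_bool \<circ> h) -` E \<longleftrightarrow> h \<in> (\<lambda>S i. i \<in> S) ` ?G"
      by (simp add: AE_measure_pmf_iff)
  qed auto
  also have "\<dots> = sum (pmf ?P) ((\<lambda>S i. i \<in> S) ` ?G)"
    by (rule measure_measure_pmf_finite) auto
  also have "\<dots> = (\<Sum>S\<in>?G. pmf ?P (\<lambda>i. i \<in> S))"
    by (subst sum.reindex) (auto simp: inj_on_def fun_eq_iff)
  also have "\<dots> = sum (Bernoulli_weight p n) ?G"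
  proof (rule sum.cong)
    fix S assume "S \<in> ?G"
    then have "pmf ?P (\<lambda>i. i \<in> S) = (\<Prod>i<n. pmf (bernoulli_pmf p) (i \<in> S))"
      by (subst pmf_Pi') auto
    also have "\<dots> = Bernoulli_weight p n S"
      unfolding Bernoulli_weight_def using p by (intro prod.cong) auto
    finally show "pmf ?P (\<lambda>i. i \<in> S) = Bernoulli_weight p n S" .
  qed simp
  finally show ?thesis .
qed

lemma prob_meval_eq_le:
  fixes f :: "real mpolynomial"
  assumes p: "0 < p" "p < 1"
    and nonneg: "\<And>m. 0 \<le> mcoeff f m" and x: "x \<noteq> mcoeff f 0"
  shows "measure_pmf.prob (Ber_vector n p) {\<xi>. meval f \<xi> = x} \<le> 1 / (exp 1 * (1 - p))"
proof -
  let ?F = "{S \<in> Pow {..<n}. meval f (\<lambda>i. of_bool (i \<in> S)) = x}"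
  have "\<exists>U\<in>?F. U \<noteq> {} \<and> U \<subseteq> S \<and> (\<forall>M\<in>?F. M \<subseteq> S \<longrightarrow> U \<subseteq> M)" if "S \<in> ?F" for S
  proof -
    from that have S: "S \<subseteq> {..<n}" "meval f (\<lambda>i. of_bool (i \<in> S)) = x" by simp_all
    from meval_level_core[OF nonneg x S(2)] obtain U where
      U: "meval f (\<lambda>i. of_bool (i \<in> U)) = x \<and> U \<noteq> {} \<and> U \<subseteq> S \<and>
        (\<forall>M. meval f (\<lambda>i. of_bool (i \<in> M)) = x \<longrightarrow> M \<subseteq> S \<longrightarrow> U \<subseteq> M)"
      by (rule exE)
    have "U \<subseteq> {..<n}" by (rule subset_trans[OF _ S(1)]) (simp add: U)
    then show ?thesis using U by (intro bexI[of _ U]) simp_all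
  qed
  then have "sum (Bernoulli_weight p n) ?F \<le> 1 / (exp 1 * (1 - p))"
    by (intro sum_weight_le_of_cores p) auto
  then show ?thesis using p by (simp add: prob_Ber_vector)
qed

theorem theorem1p10:
  shows "\<exists>g :: real \<Rightarrow> real.
    (\<forall>p. 0 < p \<and> p < 1 \<longrightarrow> 0 \<le> g p) \<and>
    (g \<longlongrightarrow> 0) (at_right 0) \<and>
    (\<forall>(n::nat) (p::real) (f :: real mpolynomial) (x::real).
       0 < p \<longrightarrow> p < 1 \<longrightarrow>
       f \<in> mpolynomials n \<longrightarrow>
       (\<forall>m. 0 \<le> mcoeff f m) \<longrightarrow>
       x \<noteq> mcoeff f 0 \<longrightarrow>
       measure_pmf.prob (Ber_vector n p) {\<xi>. meval f \<xi> = x} \<le> 1 / exp 1 + g p)"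
\<comment> \<open>This choice of \<open>g\<close> is the excess of
  \<open>1 / (exp 1 * (1 - p))\<close> over \<open>1 / exp 1\<close>.\<close>
proof (intro exI[of _ "\<lambda>p. p / (exp 1 * (1 - p))"] conjI allI impI)
  show "((\<lambda>p::real. p / (exp 1 * (1 - p))) \<longlongrightarrow> 0) (at_right 0)"
    by (rule tendsto_eq_intros refl | simp)+
next
  fix n :: nat and p x :: real and f :: "real mpolynomial"
  assume p: "0 < p" "p < 1" and "\<forall>m. 0 \<le> mcoeff f m" "x \<noteq> mcoeff f 0"
  then have "measure_pmf.prob (Ber_vector n p) {\<xi>. meval f \<xi> = x} \<le> 1 / (exp 1 * (1 - p))"
    by (intro prob_meval_eq_le) auto
  also have "\<dots> = 1 / exp 1 + p / (exp 1 * (1 - p))"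
    using p by (simp add: field_simps)
  finally show "measure_pmf.prob (Ber_vector n p) {\<xi>. meval f \<xi> = x} \<le>
      1 / exp 1 + p / (exp 1 * (1 - p))" .
qed auto

end
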